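(* Assume the two-system setup with a steady-state map $x_2^s$ defined on all of $\mathbb{R}^{n_1}$ and a steady state $x^s=(x_1^s,x_2^s(x_1^s))$. Assume $f_1,f_2$ are globally Lipschitz and there exist symmetric positive definite $P_1,Q_1,P_2,Q_2$ with $P_1\nabla_{x_1}f_1^r(x_1)+\nabla_{x_1}f_1^r(x_1)^TP_1\preceq -Q_1$ and $P_2\nabla_{x_2}f_2(x_1,x_2)+\nabla_{x_2}f_2(x_1,x_2)^TP_2\preceq -Q_2$ for all $x_1,x_2$. Let $\hat S_{x_1}^{x_2}:\mathbb{R}^{n_1}\times\mathbb{R}^{n_2}\to\mathbb{R}^{n_2\times n_1}$ be an approximate sensitivity such that the approximated predictive-sensitivity system $$\dot x_1=f_1(x_1,x_2),\qquad \dot x_2=f_2(x_1,x_2)+\hat S_{x_1}^{x_2}(x_1,x_2)f_1(x_1,x_2)$$ has a locally Lipschitz right-hand side, and define along solutions the error $\xi(t):=\|(S_{x_1}^{x_2}(x_1(t),x_2(t))-\hat S_{x_1}^{x_2}(x_1(t),x_2(t)))f_1(x_1(t),x_2(t))\|_2$. Then this system is input-to-state stable with respect to $\xi$: there exist a class-$\mathcal{KL}$ function $\beta$ and a class-$\mathcal{K}$ function $\gamma$ such that every solution $x(t)=(x_1(t),x_2(t))$ satisfies $\|x(t)-x^s\|_2\le \beta(\|x(t_0)-x^s\|_2,t-t_0)+\gamma\big(\sup_{t_0\le s\le t}\xi(s)\big)$ for all $t\ge t_0$ in its interval of existence.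
   Context: Two-system setup: Let $f_1:\mathbb{R}^{n_1}\times\mathbb{R}^{n_2}\to\mathbb{R}^{n_1}$ and $f_2:\mathbb{R}^{n_1}\times\mathbb{R}^{n_2}\to\mathbb{R}^{n_2}$ be continuously differentiable, and assume $\nabla_{x_2}f_2(x_1,x_2)$ is invertible for all $(x_1,x_2)$. Define the extended sensitivity $S_{x_1}^{x_2}(x_1,x_2):=-\nabla_{x_2}f_2(x_1,x_2)^{-1}\nabla_{x_1}f_2(x_1,x_2)\in\mathbb{R}^{n_2\times n_1}$. A steady-state map is a continuously differentiable map $x_2^s$ with $f_2(x_1,x_2^s(x_1))=0$ for all $x_1$ in its domain. The reduced vector field is $f_1^r(x_1):=f_1(x_1,x_2^s(x_1))$, with Jacobian $\nabla_{x_1}f_1^r(x_1)=\nabla_{x_1}f_1(x_1,x_2^s(x_1))+\nabla_{x_2}f_1(x_1,x_2^s(x_1))\nabla_{x_1}x_2^s(x_1)$. A steady state is a point $(x_1^s,x_2^s(x_1^s))$ with $f_1^r(x_1^s)=0$. Class-$\mathcal{K}$ and class-$\mathcal{KL}$ functions are the standard comparison functions of nonlinear systems theory. *)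

theory Defs
  imports "HOL-Analysis.Analysis"
begin

text \<open>States are pairs (x1, x2) with x1 in real^'n1 and x2 in real^'n2.
  The norm on the product type is the Euclidean norm of the stacked vector.\<close>

definition C1_map :: "('a::euclidean_space \<Rightarrow> 'b::euclidean_space) \<Rightarrow> bool" where
  "C1_map F \<longleftrightarrow> (\<exists>F'. (\<forall>z. (F has_derivative blinfun_apply (F' z)) (at z)) \<and> continuous_on UNIV F')"

text \<open>Partial Jacobians nabla_{x1} and nabla_{x2}.\<close>
definition jac1 :: "((real^'n1) \<times> (real^'n2) \<Rightarrow> real^'m) \<Rightarrow> (real^'n1) \<times> (real^'n2) \<Rightarrow> real^'n1^'m" where
  "jac1 f z = jacobian (\<lambda>y. f (y, snd z)) (at (fst z))"

definition jac2 :: "((real^'n1) \<times> (real^'n2) \<Rightarrow> real^'m) \<Rightarrow> (real^'n1) \<times> (real^'n2) \<Rightarrow> real^'n2^'m" where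
  "jac2 f z = jacobian (\<lambda>y. f (fst z, y)) (at (snd z))"

text \<open>Extended sensitivity S_{x1}^{x2}.\<close>
definition sens :: "((real^'n1) \<times> (real^'n2) \<Rightarrow> real^'n2) \<Rightarrow> (real^'n1) \<times> (real^'n2) \<Rightarrow> real^'n1^'n2" where
  "sens f2 z = - (matrix_inv (jac2 f2 z) ** jac1 f2 z)"

text \<open>Jacobian of the reduced vector field, as given by the chain-rule formula.\<close>
definition jac_red :: "((real^'n1) \<times> (real^'n2) \<Rightarrow> real^'n1) \<Rightarrow> (real^'n1 \<Rightarrow> real^'n2) \<Rightarrow> real^'n1 \<Rightarrow> real^'n1^'n1" where
  "jac_red f1 xs x1 = jac1 f1 (x1, xs x1) + jac2 f1 (x1, xs x1) ** jacobian xs (at x1)"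

definition sym_pos_def :: "real^'n^'n \<Rightarrow> bool" where
  "sym_pos_def P \<longleftrightarrow> transpose P = P \<and> (\<forall>v. v \<noteq> 0 \<longrightarrow> v \<bullet> (P *v v) > 0)"

text \<open>Loewner order A \<preceq> B (quadratic-form sense).\<close>
definition loewner_le :: "real^'n^'n \<Rightarrow> real^'n^'n \<Rightarrow> bool" where
  "loewner_le A B \<longleftrightarrow> (\<forall>v. v \<bullet> (A *v v) \<le> v \<bullet> (B *v v))"

definition locally_lipschitz :: "('a::metric_space \<Rightarrow> 'b::metric_space) \<Rightarrow> bool" where
  "locally_lipschitz F \<longleftrightarrow> (\<forall>z. \<exists>e>0. \<exists>L. L-lipschitz_on (cball z e) F)"

definition class_K :: "(real \<Rightarrow> real) \<Rightarrow> bool" where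
  "class_K g \<longleftrightarrow> continuous_on {0..} g \<and> g 0 = 0 \<and> strict_mono_on {0..} g"

definition class_KL :: "(real \<Rightarrow> real \<Rightarrow> real) \<Rightarrow> bool" where
  "class_KL b \<longleftrightarrow> continuous_on ({0..} \<times> {0..}) (\<lambda>(r, s). b r s)
     \<and> (\<forall>s\<ge>0. class_K (\<lambda>r. b r s))
     \<and> (\<forall>r\<ge>0. (\<forall>s1 s2. 0 \<le> s1 \<longrightarrow> s1 \<le> s2 \<longrightarrow> b r s2 \<le> b r s1)
              \<and> ((\<lambda>s. b r s) \<longlongrightarrow> 0) at_top)"

end

theory Submission
  imports Defs
begin

(* The fast error w = f2 x satisfies w' = J2 (w + e) with J2 = nabla_x2 f2 and e = (Shat - S) f1,
   because the exact sensitivity S satisfies J2 S = - nabla_x1 f2. Since J2 is uniformly dissipative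
   for P2, the energy w^T P2 w decays exponentially up to a term of order (sup |e|)^2, and the distance
   of x2 to the slow manifold x2 = xs x1 is at most a fixed multiple of |w|. The slow error
   y = x1 - x1s follows the contracting reduced field, perturbed by at most L1 times that distance, so
   y^T P1 y satisfies a linear differential inequality with exponentially decaying plus constant
   forcing. Solving both inequalities with an integrating factor and recombining through the
   Lipschitz continuity of xs gives
     |x t - x^s|^2 <= K exp (- rate (t - t0)) |x t0 - x^s|^2 + G (sup xi)^2,
   whose square root is the ISS estimate. *)

section \<open>Quadratic forms\<close>

definition coercivity :: "real^'n^'n \<Rightarrow> real" where
  "coercivity Q = (INF v\<in>sphere 0 1. v \<bullet> (Q *v v))"

lemma continuous_on_quadratic_form: "continuous_on S (\<lambda>v::real^'n. v \<bullet> (Q *v v))"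
  by (intro continuous_intros linear_continuous_on matrix_vector_mul_bounded_linear)

lemma coercivity_le:
  fixes Q :: "real^'n^'n"
  shows "coercivity Q * (norm v)\<^sup>2 \<le> v \<bullet> (Q *v v)"
proof (cases "v = 0")
  case False
  have "bdd_below ((\<lambda>v. v \<bullet> (Q *v v)) ` sphere 0 1)"
    by (intro bounded_imp_bdd_below compact_imp_bounded compact_continuous_image
        continuous_on_quadratic_form compact_sphere)
  moreover have "(1 / norm v) *\<^sub>R v \<in> sphere 0 1"
    using False by simp
  ultimately have "coercivity Q \<le> ((1 / norm v) *\<^sub>R v) \<bullet> (Q *v ((1 / norm v) *\<^sub>R v))"
    unfolding coercivity_def by (rule cINF_lower2) simp
  also have "\<dots> = v \<bullet> (Q *v v) / (norm v)\<^sup>2"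
    by (simp add: matrix_vector_mult_scaleR power2_eq_square divide_inverse)
  finally show ?thesis
    using False by (simp add: pos_le_divide_eq)
qed simp

lemma coercivity_pos:
  assumes "sym_pos_def (Q :: real^'n^'n)"
  shows "0 < coercivity Q"
proof -
  have "sphere (0 :: real^'n) 1 \<noteq> {}"
    by simp
  then obtain u where u: "u \<in> sphere 0 1"
    and min: "\<forall>v\<in>sphere 0 1. u \<bullet> (Q *v u) \<le> v \<bullet> (Q *v v)"
    using continuous_attains_inf[OF compact_sphere _ continuous_on_quadratic_form] by blast
  have "coercivity Q = u \<bullet> (Q *v u)"
    unfolding coercivity_def using u min by (intro cInf_eq_minimum) auto
  also have "\<dots> > 0"
    using assms u by (metis sym_pos_def_def mem_sphere_0 norm_zero zero_neq_one)
  finally show ?thesis .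
qed

lemma norm_matrix_vector_le_onorm:
  fixes A :: "real^'n^'m"
  shows "norm (A *v v) \<le> onorm ((*v) A) * norm v"
  by (rule onorm[OF matrix_vector_mul_bounded_linear])

lemma quadratic_form_le_onorm:
  fixes A :: "real^'n^'n"
  shows "v \<bullet> (A *v v) \<le> onorm ((*v) A) * (norm v)\<^sup>2"
proof -
  have "v \<bullet> (A *v v) \<le> norm v * norm (A *v v)"
    by (rule norm_cauchy_schwarz)
  also have "\<dots> \<le> norm v * (onorm ((*v) A) * norm v)"
    by (intro mult_left_mono norm_matrix_vector_le_onorm) simp
  finally show ?thesis
    by (simp add: power2_eq_square algebra_simps)
qed

lemma quadratic_form_rate_le:
  fixes P :: "real^'n^'n"
  assumes "0 < onorm ((*v) P)" "0 \<le> q"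
  shows "q / (2 * onorm ((*v) P)) * (u \<bullet> (P *v u)) \<le> (q/2) * (norm u)\<^sup>2"
proof -
  have "q / (2 * onorm ((*v) P)) * (u \<bullet> (P *v u))
      \<le> q / (2 * onorm ((*v) P)) * (onorm ((*v) P) * (norm u)\<^sup>2)"
    using assms by (intro mult_left_mono quadratic_form_le_onorm) auto
  also have "\<dots> = (q/2) * (norm u)\<^sup>2"
    using assms(1) by simp
  finally show ?thesis .
qed

lemma onorm_pos_of_sym_pos_def:
  assumes "sym_pos_def (P :: real^'n^'n)"
  shows "0 < onorm ((*v) P)"
proof -
  have "axis undefined 1 \<noteq> (0 :: real^'n)"
    by simp
  with assms have "0 < axis undefined 1 \<bullet> (P *v axis undefined 1)"
    by (simp add: sym_pos_def_def)
  then have "P *v axis undefined 1 \<noteq> 0"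
    by auto
  then show ?thesis
    using onorm_pos_lt[OF matrix_vector_mul_bounded_linear] by blast
qed

lemma matrix_vector_mult_uminus:
  fixes A :: "real^'n^'m"
  shows "(- A) *v v = - (A *v v)" and "A *v (- v) = - (A *v v)"
  by (simp_all add: matrix_vector_mult_def vec_eq_iff sum_negf)

lemma matrix_inv_right:
  fixes A :: "real^'n^'n"
  assumes "invertible A"
  shows "A ** matrix_inv A = mat 1"
  using assms unfolding invertible_def matrix_inv_def
  by (rule someI_ex[where P = "\<lambda>B. A ** B = mat 1 \<and> B ** A = mat 1", THEN conjunct1])

lemma inner_symmetric_sum_eq:
  fixes P J :: "real^'n^'n"
  assumes "transpose P = P"
  shows "v \<bullet> ((P ** J + transpose J ** P) *v v) = 2 * ((P *v v) \<bullet> (J *v v))"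
proof -
  have "v \<bullet> ((P ** J) *v v) = (P *v v) \<bullet> (J *v v)"
    by (metis assms dot_lmul_matrix matrix_vector_mul_assoc vector_transpose_matrix)
  moreover have "v \<bullet> ((transpose J ** P) *v v) = (P *v v) \<bullet> (J *v v)"
    by (metis dot_lmul_matrix inner_commute matrix_vector_mul_assoc transpose_matrix_vector)
  ultimately show ?thesis
    by (simp add: matrix_vector_mult_add_rdistrib inner_add_right)
qed

lemma inner_le_of_loewner_le:
  fixes P J Q :: "real^'n^'n"
  assumes "sym_pos_def P" and "loewner_le (P ** J + transpose J ** P) (- Q)"
  shows "(P *v v) \<bullet> (J *v v) \<le> - (coercivity Q / 2) * (norm v)\<^sup>2"
proof -
  have "transpose P = P"
    using assms(1) by (simp add: sym_pos_def_def)
  then have "2 * ((P *v v) \<bullet> (J *v v)) = v \<bullet> ((P ** J + transpose J ** P) *v v)"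
    by (simp add: inner_symmetric_sum_eq)
  also have "\<dots> \<le> v \<bullet> ((- Q) *v v)"
    using assms(2) by (simp add: loewner_le_def)
  also have "\<dots> = - (v \<bullet> (Q *v v))"
    by (simp add: matrix_vector_mult_uminus)
  finally show ?thesis
    using coercivity_le[of Q v] by simp
qed

lemma norm_le_of_inner_le:
  fixes P :: "real^'n^'n"
  assumes inner: "(P *v v) \<bullet> u \<le> - (q/2) * (norm v)\<^sup>2" and q: "0 < q"
  shows "norm v \<le> (2 * onorm ((*v) P) / q) * norm u"
proof (cases "v = 0")
  case False
  have "(q/2) * (norm v)\<^sup>2 \<le> - ((P *v v) \<bullet> u)"
    using inner by simp
  also have "\<dots> \<le> norm (P *v v) * norm u"
    using Cauchy_Schwarz_ineq2[of "P *v v" u] by (simp add: abs_le_iff)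
  also have "\<dots> \<le> onorm ((*v) P) * norm v * norm u"
    by (intro mult_right_mono norm_matrix_vector_le_onorm) simp
  finally have "(q/2) * norm v \<le> onorm ((*v) P) * norm u"
    using False by (simp add: power2_eq_square algebra_simps)
  then show ?thesis
    using q by (simp add: field_simps)
next
  case True
  have "0 \<le> onorm ((*v) P)"
    by (rule onorm_pos_le[OF matrix_vector_mul_bounded_linear])
  with True q show ?thesis
    by simp
qed

section \<open>Derivatives\<close>

lemma C1_map_differentiable: "C1_map F \<Longrightarrow> F differentiable (at z)"
  unfolding C1_map_def differentiable_def by blast

lemma continuous_on_UNIV_if_locally_lipschitz:
  fixes F :: "'a::metric_space \<Rightarrow> 'b::metric_space"
  assumes "locally_lipschitz F"
  shows "continuous_on UNIV F"
proof (intro continuous_at_imp_continuous_on ballI)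
  fix z
  obtain e L where "0 < e" "L-lipschitz_on (cball z e) F"
    using assms unfolding locally_lipschitz_def by blast
  then have "continuous_on (ball z e) F"
    using lipschitz_on_continuous_on continuous_on_subset ball_subset_cball by blast
  with \<open>0 < e\<close> show "isCont F z"
    using continuous_on_eq_continuous_at[OF open_ball, of z e F] by simp
qed

lemma norm_derivative_le_lipschitz:
  fixes f :: "'a::real_normed_vector \<Rightarrow> 'b::real_normed_vector"
  assumes lip: "L-lipschitz_on UNIV f" and der: "(f has_derivative D) (at z)"
  shows "norm (D h) \<le> L * norm h"
proof (cases "h = 0")
  case True
  then show ?thesis
    using linear_0[OF has_derivative_linear[OF der]] by simp
next
  case False
  then have hp: "norm h > 0"
    by simp
  show ?thesis
  proof (rule field_le_epsilon)
    fix e :: real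
    assume "e > 0"
    then obtain d where d: "d > 0" and dd: "\<And>y. 0 < norm (y - z) \<and> norm (y - z) < d \<Longrightarrow>
        norm (f y - f z - D (y - z)) / norm (y - z) < e / norm h"
      using der hp unfolding has_derivative_at' by (metis divide_pos_pos)
    define t where "t = d / (2 * norm h)"
    have t: "t > 0" "norm (t *\<^sub>R h) = d / 2"
      using d hp by (simp_all add: t_def)
    have "norm (f (z + t *\<^sub>R h) - f z - t *\<^sub>R D h) / (t * norm h) < e / norm h"
      using dd[of "z + t *\<^sub>R h"] t d
      by (simp add: linear_scale[OF has_derivative_linear[OF der]])
    then have approx: "norm (f (z + t *\<^sub>R h) - f z - t *\<^sub>R D h) < t * e"
      using t hp by (simp add: field_simps)
    have lipschitz: "norm (f (z + t *\<^sub>R h) - f z) \<le> L * (t * norm h)"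
      using lipschitz_onD[OF lip, of "z + t *\<^sub>R h" z] t by (simp add: dist_norm)
    have "t * norm (D h) \<le> norm (f (z + t *\<^sub>R h) - f z) + norm (f (z + t *\<^sub>R h) - f z - t *\<^sub>R D h)"
      using norm_triangle_ineq4[of "f (z + t *\<^sub>R h) - f z" "f (z + t *\<^sub>R h) - f z - t *\<^sub>R D h"] t
      by simp
    also have "\<dots> \<le> t * (L * norm h + e)"
      using approx lipschitz by (simp add: algebra_simps)
    finally show "norm (D h) \<le> L * norm h + e"
      using t by simp
  qed
qed

lemma has_derivative_partial_jacobians:
  fixes f :: "(real^'n1) \<times> (real^'n2) \<Rightarrow> real^'m"
  assumes der: "(f has_derivative D) (at z)"
  shows "(f has_derivative (\<lambda>h. jac1 f z *v fst h + jac2 f z *v snd h)) (at z)"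
proof -
  have partial: "jacobian (f \<circ> g) (at y) *v h = D (g' h)"
    if g: "(g has_derivative g') (at y)" "g y = z" for g :: "real^'k \<Rightarrow> _" and g' y h
  proof -
    have "(f \<circ> g has_derivative D \<circ> g') (at y)"
      using has_derivative_compose[OF g(1)] der g(2) by (simp add: comp_def)
    then have "jacobian (f \<circ> g) (at y) = matrix (D \<circ> g')"
      by (simp add: jacobian_def frechet_derivative_at[symmetric])
    moreover have "linear (D \<circ> g')"
      using linear_compose[OF has_derivative_linear[OF g(1)] has_derivative_linear[OF der]] .
    ultimately show ?thesis
      by (simp add: matrix_works)
  qed
  have "((\<lambda>y. (y, snd z)) has_derivative (\<lambda>h. (h, 0))) (at (fst z))"
    by (auto intro!: derivative_eq_intros)
  from partial[OF this] have jac1: "jac1 f z *v h1 = D (h1, 0)" for h1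
    by (simp add: jac1_def comp_def)
  have "((\<lambda>y. (fst z, y)) has_derivative (\<lambda>h. (0, h))) (at (snd z))"
    by (auto intro!: derivative_eq_intros)
  from partial[OF this] have jac2: "jac2 f z *v h2 = D (0, h2)" for h2
    by (simp add: jac2_def comp_def)
  have "D h = jac1 f z *v fst h + jac2 f z *v snd h" for h
    using linear_add[OF has_derivative_linear[OF der], of "(fst h, 0)" "(0, snd h)"]
    by (simp only: jac1 jac2 add_Pair add_0 add_0_right prod.collapse)
  then have "D = (\<lambda>h. jac1 f z *v fst h + jac2 f z *v snd h)"
    by blast
  with der show ?thesis
    by simp
qed

lemma mvt_inner_segment:
  fixes f :: "'a::real_normed_vector \<Rightarrow> 'b::real_inner"
  assumes der: "\<And>z. (f has_derivative Df z) (at z)"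
  shows "\<exists>\<theta>. p \<bullet> f b - p \<bullet> f a = p \<bullet> Df (a + \<theta> *\<^sub>R (b - a)) (b - a)"
proof -
  define g where "g t = p \<bullet> f (a + t *\<^sub>R (b - a))" for t
  have dg: "(g has_derivative (\<lambda>s. p \<bullet> Df (a + t *\<^sub>R (b - a)) (s *\<^sub>R (b - a)))) (at t)" for t
  proof -
    have "((\<lambda>t. a + t *\<^sub>R (b - a)) has_derivative (\<lambda>s. s *\<^sub>R (b - a))) (at t)"
      by (auto intro!: derivative_eq_intros)
    from has_derivative_compose[OF this der] show ?thesis
      unfolding g_def by (auto intro!: derivative_eq_intros)
  qed
  have "continuous_on {0..1} g"
    by (intro continuous_at_imp_continuous_on ballI has_derivative_continuous[OF dg])
  then obtain \<theta> where "g 1 - g 0 = p \<bullet> Df (a + \<theta> *\<^sub>R (b - a)) ((1 - 0) *\<^sub>R (b - a))"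
    using mvt[of 0 1 g, OF _ _ dg] by auto
  then show ?thesis
    by (auto simp: g_def)
qed

lemma quadratic_form_has_real_derivative:
  fixes P :: "real^'n^'n"
  assumes sym: "transpose P = P" and w: "(w has_vector_derivative w') (at s)"
  shows "((\<lambda>s. w s \<bullet> (P *v w s)) has_real_derivative 2 * ((P *v w s) \<bullet> w')) (at s)"
proof -
  have dw: "(w has_derivative (\<lambda>h. h *\<^sub>R w')) (at s)"
    using w by (simp add: has_vector_derivative_def)
  have "((\<lambda>s. w s \<bullet> (P *v w s)) has_derivative
      (\<lambda>h. w s \<bullet> (P *v (h *\<^sub>R w')) + (h *\<^sub>R w') \<bullet> (P *v w s))) (at s)"
    using has_derivative_inner[OF dw bounded_linear.has_derivative[OF matrix_vector_mul_bounded_linear dw]] .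
  moreover have "w s \<bullet> (P *v (h *\<^sub>R w')) + (h *\<^sub>R w') \<bullet> (P *v w s) = h * (2 * ((P *v w s) \<bullet> w'))"
    for h
  proof -
    have "w s \<bullet> (P *v w') = (P *v w s) \<bullet> w'"
      by (metis dot_lmul_matrix sym vector_transpose_matrix)
    then show ?thesis
      by (simp add: inner_commute[of w'] matrix_vector_mult_scaleR)
  qed
  ultimately show ?thesis
    by (intro has_derivative_imp_has_field_derivative) auto
qed

lemma has_vector_derivative_on_subinterval:
  assumes J: "is_interval J" "t0 \<in> J" "T \<in> J"
    and der: "\<forall>t\<in>J. (x has_vector_derivative x' t) (at t within J)"
  shows "continuous_on {t0..T} x"
    and "\<And>s. t0 < s \<Longrightarrow> s < T \<Longrightarrow> (x has_vector_derivative x' s) (at s)"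
proof -
  have sub: "{t0..T} \<subseteq> J"
    using J unfolding is_interval_1 atLeastAtMost_iff subset_iff by blast
  have "continuous (at t within J) x" if "t \<in> J" for t
    using der that by (blast intro: has_vector_derivative_continuous)
  then have "continuous_on J x"
    by (simp add: continuous_on_eq_continuous_within)
  then show "continuous_on {t0..T} x"
    using sub by (rule continuous_on_subset)
  fix s
  assume "t0 < s" "s < T"
  then have s: "s \<in> interior J"
    using interior_mono[OF sub] by auto
  then have "(x has_vector_derivative x' s) (at s within J)"
    using der interior_subset by blast
  then show "(x has_vector_derivative x' s) (at s)"
    by (simp add: at_within_interior[OF s])
qed

section \<open>Differential inequalities and comparison functions\<close>

lemma two_mult_le_weighted_squares:
  fixes q x y :: real
  assumes "0 < q"
  shows "2 * x * y \<le> (q/2) * x\<^sup>2 + (2/q) * y\<^sup>2"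
proof -
  have "0 \<le> (q/2) * (x - 2 * y / q)\<^sup>2"
    using assms by simp
  also have "\<dots> = (q/2) * x\<^sup>2 + (2/q) * y\<^sup>2 - 2 * x * y"
    using assms by (simp add: power2_eq_square field_simps)
  finally show ?thesis
    by simp
qed

lemma integrating_factor_nonincreasing:
  fixes V V' :: "real \<Rightarrow> real"
  assumes "t0 \<le> T" and a: "0 < a" "0 < a - \<alpha>"
    and cont: "continuous_on {t0..T} V"
    and der: "\<And>t. t0 < t \<Longrightarrow> t < T \<Longrightarrow> (V has_real_derivative V' t) (at t)"
    and ineq: "\<And>t. t0 < t \<Longrightarrow> t < T \<Longrightarrow> V' t \<le> - a * V t + A * exp (- \<alpha> * (t - t0)) + B"
  shows "exp (a * (T - t0)) * V T - A / (a - \<alpha>) * exp ((a - \<alpha>) * (T - t0)) - B / a * exp (a * (T - t0))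
    \<le> V t0 - A / (a - \<alpha>) - B / a"
proof -
  define G where "G t = exp (a * (t - t0)) * V t - A / (a - \<alpha>) * exp ((a - \<alpha>) * (t - t0))
      - B / a * exp (a * (t - t0))" for t
  have "G T \<le> G t0"
  proof (rule DERIV_nonpos_imp_decreasing_open[OF \<open>t0 \<le> T\<close>])
    fix t
    assume t: "t0 < t" "t < T"
    have "(G has_real_derivative
        a * exp (a * (t - t0)) * V t + exp (a * (t - t0)) * V' t
        - A / (a - \<alpha>) * ((a - \<alpha>) * exp ((a - \<alpha>) * (t - t0)))
        - B / a * (a * exp (a * (t - t0)))) (at t)"
      unfolding G_def by (rule derivative_eq_intros der[OF t] refl | simp)+
    moreover have "exp ((a - \<alpha>) * (t - t0)) = exp (a * (t - t0)) * exp (- \<alpha> * (t - t0))"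
      by (simp add: exp_add[symmetric] algebra_simps)
    then have "A / (a - \<alpha>) * ((a - \<alpha>) * exp ((a - \<alpha>) * (t - t0)))
        = A * (exp (a * (t - t0)) * exp (- \<alpha> * (t - t0)))"
      using a by simp
    moreover have "B / a * (a * exp (a * (t - t0))) = B * exp (a * (t - t0))"
      using a by simp
    ultimately have "(G has_real_derivative
        exp (a * (t - t0)) * (a * V t + V' t - A * exp (- \<alpha> * (t - t0)) - B)) (at t)"
      by (simp only:) (simp add: algebra_simps)
    moreover have "exp (a * (t - t0)) * (a * V t + V' t - A * exp (- \<alpha> * (t - t0)) - B) \<le> 0"
      using ineq[OF t] by (intro mult_nonneg_nonpos) auto
    ultimately show "\<exists>y. (G has_real_derivative y) (at t) \<and> y \<le> 0"
      by blast
  qed (unfold G_def, intro continuous_intros cont)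
  then show ?thesis
    by (simp add: G_def)
qed

lemma exp_decay_of_differential_inequality:
  fixes V V' :: "real \<Rightarrow> real"
  assumes "t0 \<le> T" and \<alpha>: "0 < \<alpha>" "\<alpha> < a" and "0 \<le> A" "0 \<le> B" "0 \<le> V t0"
    and cont: "continuous_on {t0..T} V"
    and der: "\<And>t. t0 < t \<Longrightarrow> t < T \<Longrightarrow> (V has_real_derivative V' t) (at t)"
    and ineq: "\<And>t. t0 < t \<Longrightarrow> t < T \<Longrightarrow> V' t \<le> - a * V t + A * exp (- \<alpha> * (t - t0)) + B"
  shows "V T \<le> exp (- \<alpha> * (T - t0)) * (V t0 + A / (a - \<alpha>)) + B / a"
proof -
  have a: "0 < a" "0 < a - \<alpha>"
    using \<alpha> by auto
  have "exp (a * (T - t0)) * V T \<le> V t0 - A / (a - \<alpha>) - B / a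
      + A / (a - \<alpha>) * exp ((a - \<alpha>) * (T - t0)) + B / a * exp (a * (T - t0))"
    using integrating_factor_nonincreasing[OF \<open>t0 \<le> T\<close> a cont der ineq] by simp
  also have "\<dots> \<le> V t0 + A / (a - \<alpha>) * exp ((a - \<alpha>) * (T - t0)) + B / a * exp (a * (T - t0))"
    using a \<open>0 \<le> A\<close> \<open>0 \<le> B\<close> divide_nonneg_pos[of A "a - \<alpha>"] divide_nonneg_pos[of B a]
    by linarith
  also have "\<dots> \<le> exp (a * (T - t0)) * (exp (- \<alpha> * (T - t0)) * (V t0 + A / (a - \<alpha>)) + B / a)"
  proof -
    have e: "exp ((a - \<alpha>) * (T - t0)) = exp (a * (T - t0)) * exp (- \<alpha> * (T - t0))"
      by (simp add: exp_add[symmetric] algebra_simps)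
    have "1 \<le> exp ((a - \<alpha>) * (T - t0))"
      using a \<open>t0 \<le> T\<close> by simp
    then have "V t0 \<le> exp ((a - \<alpha>) * (T - t0)) * V t0"
      using mult_right_mono[OF _ \<open>0 \<le> V t0\<close>] by fastforce
    then show ?thesis
      unfolding e by (simp add: algebra_simps)
  qed
  finally show ?thesis
    by simp
qed

lemma quadratic_lyapunov_decay:
  fixes v v' :: "real \<Rightarrow> real^'n" and P :: "real^'n^'n"
  assumes P: "sym_pos_def P" and q: "0 < q"
    and rate: "\<And>u. a * (u \<bullet> (P *v u)) \<le> (q/2) * (norm u)\<^sup>2"
    and T: "t0 \<le> T" and \<alpha>: "0 < \<alpha>" "\<alpha> < a" and AB: "0 \<le> A" "0 \<le> B"
    and cont: "continuous_on {t0..T} v"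
    and der: "\<And>s. t0 < s \<Longrightarrow> s < T \<Longrightarrow> (v has_vector_derivative v' s) (at s)"
    and dissipation: "\<And>s. t0 < s \<Longrightarrow> s < T \<Longrightarrow>
      (P *v v s) \<bullet> v' s \<le> - (q/2) * (norm (v s))\<^sup>2 + norm (v s) * c s"
    and forcing: "\<And>s. t0 < s \<Longrightarrow> s < T \<Longrightarrow> (c s)\<^sup>2 \<le> A * exp (- \<alpha> * (s - t0)) + B"
  shows "v T \<bullet> (P *v v T) \<le>
    exp (- \<alpha> * (T - t0)) * (v t0 \<bullet> (P *v v t0) + (2/q) * A / (a - \<alpha>)) + (2/q) * B / a"
proof (rule exp_decay_of_differential_inequality[where V' = "\<lambda>s. 2 * ((P *v v s) \<bullet> v' s)"])
  have "\<And>u. 0 \<le> u \<bullet> (P *v u)"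
    using P by (metis inner_zero_left less_imp_le sym_pos_def_def order_refl)
  moreover have "transpose P = P"
    using P by (simp add: sym_pos_def_def)
  ultimately show "0 \<le> v t0 \<bullet> (P *v v t0)"
    and "\<And>s. t0 < s \<Longrightarrow> s < T \<Longrightarrow>
      ((\<lambda>s. v s \<bullet> (P *v v s)) has_real_derivative 2 * ((P *v v s) \<bullet> v' s)) (at s)"
    by (auto intro: quadratic_form_has_real_derivative der)
  show "continuous_on {t0..T} (\<lambda>s. v s \<bullet> (P *v v s))"
    by (intro continuous_intros cont bounded_linear.continuous_on[OF matrix_vector_mul_bounded_linear])
  fix s
  assume s: "t0 < s" "s < T"
  have "2 * ((P *v v s) \<bullet> v' s) \<le> - q * (norm (v s))\<^sup>2 + 2 * norm (v s) * c s"
    using dissipation[OF s] by simp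
  also have "\<dots> \<le> - (q/2) * (norm (v s))\<^sup>2 + (2/q) * (c s)\<^sup>2"
    using two_mult_le_weighted_squares[OF q, of "norm (v s)" "c s"] by simp
  also have "\<dots> \<le> - a * (v s \<bullet> (P *v v s)) + (2/q) * A * exp (- \<alpha> * (s - t0)) + (2/q) * B"
    using rate[of "v s"] mult_left_mono[OF forcing[OF s], of "2/q"] q by (simp add: algebra_simps)
  finally show "2 * ((P *v v s) \<bullet> v' s) \<le>
      - a * (v s \<bullet> (P *v v s)) + (2/q) * A * exp (- \<alpha> * (s - t0)) + (2/q) * B" .
qed (use T \<alpha> AB q in simp_all)

lemma class_K_scale: "0 < c \<Longrightarrow> class_K (\<lambda>u. c * u)"
  unfolding class_K_def by (auto intro!: continuous_intros simp: strict_mono_on_def)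

lemma class_KL_exp_decay:
  assumes c: "0 < c" and l: "0 < l"
  shows "class_KL (\<lambda>r s. c * r * exp (- l * s))"
proof -
  have "((\<lambda>s. exp (- l * s)) \<longlongrightarrow> 0) at_top"
    using l by real_asymp
  then have "((\<lambda>s. c * r * exp (- l * s)) \<longlongrightarrow> 0) at_top" for r
    by (intro tendsto_mult_right_zero)
  moreover have "class_K (\<lambda>r. c * r * exp (- l * s))" for s
    using class_K_scale[of "c * exp (- l * s)"] c by (simp add: mult_ac)
  moreover have "c * r * exp (- l * s2) \<le> c * r * exp (- l * s1)" if "0 \<le> r" "s1 \<le> s2" for r s1 s2
    using c l that by (intro mult_left_mono) auto
  ultimately show ?thesis
    unfolding class_KL_def by (auto simp: case_prod_beta intro!: continuous_intros)
qed

lemma norm_fst_snd_le: "norm (fst z) \<le> norm z" "norm (snd z) \<le> norm z"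
  using norm_fst_le[of "fst z" "snd z"] norm_snd_le[of "snd z" "fst z"] by simp_all

lemma le_sqrt_weighted_squares:
  fixes n r u K G :: real
  assumes "0 \<le> K" "0 \<le> G" and n: "n\<^sup>2 \<le> K * r\<^sup>2 + G * u\<^sup>2"
  shows "n \<le> sqrt K * \<bar>r\<bar> + sqrt G * \<bar>u\<bar>"
proof -
  have "n \<le> sqrt (K * r\<^sup>2 + G * u\<^sup>2)"
    using n real_le_rsqrt by blast
  also have "\<dots> \<le> sqrt (K * r\<^sup>2) + sqrt (G * u\<^sup>2)"
    using assms by (intro sqrt_add_le_add_sqrt) auto
  finally show ?thesis
    by (simp add: real_sqrt_mult)
qed

section \<open>The predictive-sensitivity system\<close>

locale predictive_sensitivity_system =
  fixes f1 :: "(real^'n1) \<times> (real^'n2) \<Rightarrow> real^'n1"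
    and f2 :: "(real^'n1) \<times> (real^'n2) \<Rightarrow> real^'n2"
    and xs :: "real^'n1 \<Rightarrow> real^'n2"
    and x1s :: "real^'n1"
    and P1 Q1 :: "real^'n1^'n1"
    and P2 Q2 :: "real^'n2^'n2"
    and Shat :: "(real^'n1) \<times> (real^'n2) \<Rightarrow> real^'n1^'n2"
    and L1 L2 :: real
  assumes f1_differentiable: "\<And>z. f1 differentiable (at z)"
    and f2_differentiable: "\<And>z. f2 differentiable (at z)"
    and xs_differentiable: "\<And>x1. xs differentiable (at x1)"
    and jac2_invertible: "\<And>z. invertible (jac2 f2 z)"
    and steady_state_map: "\<And>x1. f2 (x1, xs x1) = 0"
    and steady_state: "f1 (x1s, xs x1s) = 0"
    and lipschitz_f1: "L1-lipschitz_on UNIV f1"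
    and lipschitz_f2: "L2-lipschitz_on UNIV f2"
    and P1: "sym_pos_def P1" and Q1: "sym_pos_def Q1"
    and P2: "sym_pos_def P2" and Q2: "sym_pos_def Q2"
    and contraction_reduced:
      "\<And>x1. loewner_le (P1 ** jac_red f1 xs x1 + transpose (jac_red f1 xs x1) ** P1) (- Q1)"
    and contraction_fast: "\<And>z. loewner_le (P2 ** jac2 f2 z + transpose (jac2 f2 z) ** P2) (- Q2)"
    and vector_field_continuous: "continuous_on UNIV (\<lambda>z. (f1 z, f2 z + Shat z *v f1 z))"
begin

abbreviation "q1 \<equiv> coercivity Q1"
abbreviation "q2 \<equiv> coercivity Q2"
abbreviation "m1 \<equiv> coercivity P1"
abbreviation "m2 \<equiv> coercivity P2"
abbreviation "p1 \<equiv> onorm ((*v) P1)"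
abbreviation "p2 \<equiv> onorm ((*v) P2)"

abbreviation "gain \<equiv> 2 * p2 / q2"

text \<open>Strictly below both decay rates \<open>q\<^sub>i / (2 p\<^sub>i)\<close> of the Lyapunov functions, as the
  comparison principle requires.\<close>
abbreviation "rate \<equiv> min (q1 / (2 * p1)) (q2 / (2 * p2)) / 2"

abbreviation "xstar \<equiv> (x1s, xs x1s)"

abbreviation "sens_error z \<equiv> norm ((sens f2 z - Shat z) *v f1 z)"

abbreviation "sup_error x t0 T \<equiv> SUP s\<in>{t0..T}. sens_error (x s)"

definition solves :: "(real \<Rightarrow> (real^'n1) \<times> (real^'n2)) \<Rightarrow> real \<Rightarrow> real \<Rightarrow> bool" where
  "solves x t0 T \<longleftrightarrow> t0 \<le> T \<and> continuous_on {t0..T} x \<and>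
    (\<forall>s. t0 < s \<and> s < T \<longrightarrow> (x has_vector_derivative (f1 (x s), f2 (x s) + Shat (x s) *v f1 (x s))) (at s))"

lemma constants_pos: "0 < q1" "0 < q2" "0 < m1" "0 < m2" "0 < p1" "0 < p2" "0 \<le> L1" "0 \<le> L2"
  using coercivity_pos[OF Q1] coercivity_pos[OF Q2] coercivity_pos[OF P1] coercivity_pos[OF P2]
    onorm_pos_of_sym_pos_def[OF P1] onorm_pos_of_sym_pos_def[OF P2]
    lipschitz_on_nonneg[OF lipschitz_f1] lipschitz_on_nonneg[OF lipschitz_f2]
  by auto

lemma rate_pos: "0 < rate" "rate < q1 / (2 * p1)" "rate < q2 / (2 * p2)"
proof -
  have half_min: "0 < min a b / 2 \<and> min a b / 2 < a \<and> min a b / 2 < b"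
    if "0 < a" "0 < b" for a b :: real
    using that by (auto simp: min_def)
  have "0 < q1 / (2 * p1)" "0 < q2 / (2 * p2)"
    using constants_pos by simp_all
  from half_min[OF this] show "0 < rate" "rate < q1 / (2 * p1)" "rate < q2 / (2 * p2)"
    by blast+
qed

lemma f2_has_derivative: "(f2 has_derivative (\<lambda>h. jac1 f2 z *v fst h + jac2 f2 z *v snd h)) (at z)"
  using f2_differentiable has_derivative_partial_jacobians unfolding differentiable_def by blast

lemma norm_jac1_f2_le: "norm (jac1 f2 z *v h) \<le> L2 * norm h"
  using norm_derivative_le_lipschitz[OF lipschitz_f2 f2_has_derivative, of z "(h, 0)"]
  by (simp add: norm_Pair)

lemma norm_jac2_f2_le: "norm (jac2 f2 z *v h) \<le> L2 * norm h"
  using norm_derivative_le_lipschitz[OF lipschitz_f2 f2_has_derivative, of z "(0, h)"]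
  by (simp add: norm_Pair)

lemma fast_dissipation: "(P2 *v v) \<bullet> (jac2 f2 z *v v) \<le> - (q2/2) * (norm v)\<^sup>2"
  using inner_le_of_loewner_le[OF P2 contraction_fast] .

lemma dist_slow_manifold_le: "norm (x2 - xs x1) \<le> gain * norm (f2 (x1, x2))"
proof -
  define d where "d = x2 - xs x1"
  obtain \<theta> where "(P2 *v d) \<bullet> f2 (x1, x2) - (P2 *v d) \<bullet> f2 (x1, xs x1)
      = (P2 *v d) \<bullet> (jac1 f2 ((x1, xs x1) + \<theta> *\<^sub>R ((x1, x2) - (x1, xs x1))) *v 0
          + jac2 f2 ((x1, xs x1) + \<theta> *\<^sub>R ((x1, x2) - (x1, xs x1))) *v d)"
    using mvt_inner_segment[OF f2_has_derivative, of "P2 *v d" "(x1, x2)" "(x1, xs x1)"]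
    by (auto simp: d_def)
  then have "(P2 *v d) \<bullet> f2 (x1, x2) \<le> - (q2/2) * (norm d)\<^sup>2"
    using fast_dissipation steady_state_map by (simp add: matrix_vector_mult_0_right)
  then show ?thesis
    unfolding d_def using norm_le_of_inner_le constants_pos by blast
qed

lemma xs_lipschitz: "norm (xs a - xs b) \<le> gain * L2 * norm (a - b)"
proof -
  have "norm (f2 (b, xs a)) = dist (f2 (b, xs a)) (f2 (a, xs a))"
    using steady_state_map by (simp add: dist_norm)
  also have "\<dots> \<le> L2 * norm (a - b)"
    using lipschitz_onD[OF lipschitz_f2, of "(b, xs a)" "(a, xs a)"]
    by (simp add: dist_Pair_Pair dist_norm norm_minus_commute)
  finally have "gain * norm (f2 (b, xs a)) \<le> gain * (L2 * norm (a - b))"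
    using constants_pos by (intro mult_left_mono) auto
  then show ?thesis
    using dist_slow_manifold_le[of "xs a" b] by simp
qed

lemma jac2_sens: "jac2 f2 z *v (sens f2 z *v v) = - (jac1 f2 z *v v)"
  by (simp add: sens_def matrix_vector_mult_uminus matrix_vector_mul_assoc matrix_mul_assoc
      matrix_inv_right[OF jac2_invertible])

lemma norm_sens_le: "norm (sens f2 z *v v) \<le> gain * L2 * norm v"
proof -
  have "norm (sens f2 z *v v) \<le> gain * norm (jac2 f2 z *v (sens f2 z *v v))"
    using norm_le_of_inner_le[OF fast_dissipation] constants_pos by blast
  also have "\<dots> = gain * norm (jac1 f2 z *v v)"
    by (simp add: jac2_sens)
  also have "\<dots> \<le> gain * (L2 * norm v)"
    using constants_pos by (intro mult_left_mono norm_jac1_f2_le) simp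
  finally show ?thesis
    by simp
qed

lemma reduced_has_derivative:
  "((\<lambda>u. f1 (u, xs u)) has_derivative (\<lambda>h. jac_red f1 xs u *v h)) (at u)"
proof -
  have "((\<lambda>u. (u, xs u)) has_derivative (\<lambda>h. (h, jacobian xs (at u) *v h))) (at u)"
    using jacobian_works[THEN iffD1, OF xs_differentiable]
    by (intro has_derivative_Pair has_derivative_ident)
  moreover have "(f1 has_derivative (\<lambda>h. jac1 f1 (u, xs u) *v fst h + jac2 f1 (u, xs u) *v snd h))
      (at (u, xs u))"
    using f1_differentiable has_derivative_partial_jacobians unfolding differentiable_def by blast
  ultimately show ?thesis
    using has_derivative_compose[of "\<lambda>u. (u, xs u)"]
    by (fastforce simp: jac_red_def matrix_vector_mult_add_rdistrib matrix_vector_mul_assoc)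
qed

lemma reduced_dissipation:
  "(P1 *v (u - v)) \<bullet> (f1 (u, xs u) - f1 (v, xs v)) \<le> - (q1/2) * (norm (u - v))\<^sup>2"
proof -
  obtain \<theta> where "(P1 *v (u - v)) \<bullet> f1 (u, xs u) - (P1 *v (u - v)) \<bullet> f1 (v, xs v) =
      (P1 *v (u - v)) \<bullet> (jac_red f1 xs (v + \<theta> *\<^sub>R (u - v)) *v (u - v))"
    using mvt_inner_segment[where f = "\<lambda>u. f1 (u, xs u)", OF reduced_has_derivative] by blast
  then show ?thesis
    using inner_le_of_loewner_le[OF P1 contraction_reduced] by (simp add: inner_diff_right)
qed

lemma solves_le: "solves x t0 T \<Longrightarrow> t0 \<le> s \<Longrightarrow> s \<le> T \<Longrightarrow> solves x t0 s"
  unfolding solves_def by (auto elim: continuous_on_subset)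

lemma f2_along_solution:
  assumes "(x has_vector_derivative (f1 (x s), f2 (x s) + Shat (x s) *v f1 (x s))) (at s)"
  shows "((\<lambda>s. f2 (x s)) has_vector_derivative
    jac2 f2 (x s) *v (f2 (x s) + (Shat (x s) - sens f2 (x s)) *v f1 (x s))) (at s)"
proof -
  have "((\<lambda>s. f2 (x s)) has_derivative (\<lambda>h. jac1 f2 (x s) *v (h *\<^sub>R f1 (x s))
      + jac2 f2 (x s) *v (h *\<^sub>R (f2 (x s) + Shat (x s) *v f1 (x s))))) (at s)"
    using has_derivative_compose[OF assms[unfolded has_vector_derivative_def] f2_has_derivative]
    by simp
  moreover have "jac1 f2 (x s) *v f1 (x s) = - (jac2 f2 (x s) *v (sens f2 (x s) *v f1 (x s)))"
    by (simp add: jac2_sens)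
  ultimately show ?thesis
    by (simp add: has_vector_derivative_def matrix_vector_mult_scaleR matrix_vector_right_distrib
        matrix_vector_mult_diff_rdistrib matrix_vector_mult_diff_distrib algebra_simps)
qed

lemma fast_dissipation_perturbed:
  "(P2 *v w) \<bullet> (jac2 f2 z *v (w + e)) \<le> - (q2/2) * (norm w)\<^sup>2 + norm w * (p2 * L2 * norm e)"
proof -
  have "(P2 *v w) \<bullet> (jac2 f2 z *v e) \<le> norm (P2 *v w) * norm (jac2 f2 z *v e)"
    by (rule norm_cauchy_schwarz)
  also have "\<dots> \<le> (p2 * norm w) * (L2 * norm e)"
    using constants_pos by (intro mult_mono norm_matrix_vector_le_onorm norm_jac2_f2_le) auto
  finally show ?thesis
    using fast_dissipation[of w z] by (simp add: matrix_vector_right_distrib inner_add_right algebra_simps)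
qed

lemma reduced_dissipation_perturbed:
  "(P1 *v (fst z - x1s)) \<bullet> f1 z
    \<le> - (q1/2) * (norm (fst z - x1s))\<^sup>2 + norm (fst z - x1s) * (p1 * L1 * norm (snd z - xs (fst z)))"
proof -
  obtain z1 z2 where z: "z = (z1, z2)"
    by fastforce
  have "f1 z = (f1 (z1, xs z1) - f1 (x1s, xs x1s)) + (f1 (z1, z2) - f1 (z1, xs z1))"
    using steady_state z by simp
  moreover have "(P1 *v (z1 - x1s)) \<bullet> (f1 (z1, z2) - f1 (z1, xs z1))
      \<le> norm (P1 *v (z1 - x1s)) * norm (f1 (z1, z2) - f1 (z1, xs z1))"
    by (rule norm_cauchy_schwarz)
  moreover have "norm (f1 (z1, z2) - f1 (z1, xs z1)) \<le> L1 * norm (z2 - xs z1)"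
    using lipschitz_onD[OF lipschitz_f1, of "(z1, z2)" "(z1, xs z1)"] by (simp add: dist_Pair_Pair dist_norm)
  then have "norm (P1 *v (z1 - x1s)) * norm (f1 (z1, z2) - f1 (z1, xs z1))
      \<le> (p1 * norm (z1 - x1s)) * (L1 * norm (z2 - xs z1))"
    using constants_pos by (intro mult_mono norm_matrix_vector_le_onorm) auto
  ultimately show ?thesis
    using reduced_dissipation[of z1 x1s] z by (simp add: inner_add_right algebra_simps)
qed

lemma norm_f2_le_dist_steady_state: "norm (f2 z) \<le> L2 * (1 + gain * L2) * norm (z - xstar)"
proof -
  obtain z1 z2 where z: "z = (z1, z2)"
    by fastforce
  have "norm (z2 - xs z1) \<le> norm (z2 - xs x1s) + norm (xs x1s - xs z1)"
    using norm_triangle_ineq[of "z2 - xs x1s" "xs x1s - xs z1"] by simp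
  also have "\<dots> \<le> norm (z - xstar) + gain * L2 * norm (z - xstar)"
  proof (intro add_mono order_trans[OF xs_lipschitz])
    show "norm (z2 - xs x1s) \<le> norm (z - xstar)"
      using norm_fst_snd_le(2)[of "z - xstar"] z by simp
    have "norm (x1s - z1) \<le> norm (z - xstar)"
      using norm_fst_snd_le(1)[of "z - xstar"] z by (simp add: norm_minus_commute)
    then show "gain * L2 * norm (x1s - z1) \<le> gain * L2 * norm (z - xstar)"
      using constants_pos by (intro mult_left_mono) auto
  qed
  finally have dist: "norm (z2 - xs z1) \<le> (1 + gain * L2) * norm (z - xstar)"
    by (simp add: algebra_simps)
  have "norm (f2 z) = dist (f2 (z1, z2)) (f2 (z1, xs z1))"
    using steady_state_map z by (simp add: dist_norm)
  also have "\<dots> \<le> L2 * norm (z2 - xs z1)"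
    using lipschitz_onD[OF lipschitz_f2, of "(z1, z2)" "(z1, xs z1)"] by (simp add: dist_Pair_Pair dist_norm)
  also have "\<dots> \<le> L2 * ((1 + gain * L2) * norm (z - xstar))"
    using dist constants_pos by (intro mult_left_mono) auto
  finally show ?thesis
    by (simp add: mult.assoc)
qed

text \<open>\<open>Shat\<close> need not be continuous, so the supremum of the error is finite only because
  \<open>Shat z *v f1 z\<close> is the difference of two continuous functions.\<close>
lemma sens_error_le_sup:
  assumes sol: "solves x t0 T" and s: "s \<in> {t0..T}"
  shows "sens_error (x s) \<le> sup_error x t0 T"
proof -
  define \<phi> where "\<phi> z = norm (snd (f1 z, f2 z + Shat z *v f1 z) - f2 z) + gain * L2 * norm (f1 z)" for z
  have le: "sens_error z \<le> \<phi> z" for z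
  proof -
    have "sens_error z \<le> norm (sens f2 z *v f1 z) + norm (Shat z *v f1 z)"
      using norm_triangle_ineq4 by (simp add: matrix_vector_mult_diff_rdistrib)
    then show ?thesis
      using norm_sens_le[of z "f1 z"] by (simp add: \<phi>_def)
  qed
  moreover have "continuous_on {t0..T} (\<phi> \<circ> x)"
  proof (rule continuous_on_compose)
    show "continuous_on {t0..T} x"
      using sol by (simp add: solves_def)
    have "continuous_on UNIV \<phi>"
      unfolding \<phi>_def using lipschitz_on_continuous_on[OF lipschitz_f1]
        lipschitz_on_continuous_on[OF lipschitz_f2]
      by (intro continuous_intros continuous_on_compose2[OF vector_field_continuous]) auto
    then show "continuous_on (x ` {t0..T}) \<phi>"
      by (rule continuous_on_subset) simp
  qed
  then have "bdd_above ((\<phi> \<circ> x) ` {t0..T})"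
    by (intro bounded_imp_bdd_above compact_imp_bounded compact_continuous_image compact_Icc)
  then obtain M where M: "\<forall>s\<in>{t0..T}. \<phi> (x s) \<le> M"
    by (auto simp: bdd_above_def)
  then have "bdd_above ((\<lambda>s. sens_error (x s)) ` {t0..T})"
    by (intro bdd_aboveI2[where M = M]) (meson le order_trans)
  then show ?thesis
    using s by (rule cSUP_upper[rotated])
qed

lemma sup_error_nonneg: "solves x t0 T \<Longrightarrow> 0 \<le> sup_error x t0 T"
  using sens_error_le_sup[of x t0 T t0] by (force simp: solves_def intro: order_trans[OF norm_ge_zero])


lemma norm_sens_error_swap: "norm ((Shat z - sens f2 z) *v f1 z) = sens_error z"
  by (metis matrix_vector_mult_diff_rdistrib norm_minus_commute)

lemma fast_energy_decay:
  assumes sol: "solves x t0 T" and s: "s \<in> {t0..T}"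
  shows "f2 (x s) \<bullet> (P2 *v f2 (x s)) \<le> exp (- rate * (s - t0)) * (f2 (x t0) \<bullet> (P2 *v f2 (x t0)))
    + (2/q2) * (p2 * L2 * sup_error x t0 T)\<^sup>2 / (q2 / (2 * p2))"
proof -
  let ?U = "sup_error x t0 T"
  have sol_s: "solves x t0 s"
    using solves_le sol s by auto
  have "f2 (x s) \<bullet> (P2 *v f2 (x s)) \<le> exp (- rate * (s - t0)) * (f2 (x t0) \<bullet> (P2 *v f2 (x t0))
      + (2/q2) * 0 / (q2 / (2 * p2) - rate)) + (2/q2) * (p2 * L2 * ?U)\<^sup>2 / (q2 / (2 * p2))"
  proof (rule quadratic_lyapunov_decay[where v = "\<lambda>\<sigma>. f2 (x \<sigma>)" and c = "\<lambda>_. p2 * L2 * ?U"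
        and v' = "\<lambda>\<sigma>. jac2 f2 (x \<sigma>) *v (f2 (x \<sigma>) + (Shat (x \<sigma>) - sens f2 (x \<sigma>)) *v f1 (x \<sigma>))"])
    show "q2 / (2 * p2) * (u \<bullet> (P2 *v u)) \<le> (q2/2) * (norm u)\<^sup>2" for u
      using constants_pos by (intro quadratic_form_rate_le) auto
    show "continuous_on {t0..s} (\<lambda>\<sigma>. f2 (x \<sigma>))"
      using sol_s lipschitz_on_continuous_on[OF lipschitz_f2]
      by (auto simp: solves_def intro: continuous_on_compose2)
    fix \<sigma>
    assume \<sigma>: "t0 < \<sigma>" "\<sigma> < s"
    then show "((\<lambda>\<sigma>. f2 (x \<sigma>)) has_vector_derivative
        jac2 f2 (x \<sigma>) *v (f2 (x \<sigma>) + (Shat (x \<sigma>) - sens f2 (x \<sigma>)) *v f1 (x \<sigma>))) (at \<sigma>)"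
      using sol_s by (intro f2_along_solution) (simp add: solves_def)
    let ?e = "(Shat (x \<sigma>) - sens f2 (x \<sigma>)) *v f1 (x \<sigma>)"
    have "norm ?e \<le> ?U"
      using sens_error_le_sup[OF sol] \<sigma> s by (simp add: norm_sens_error_swap)
    then have "norm (f2 (x \<sigma>)) * (p2 * L2 * norm ?e) \<le> norm (f2 (x \<sigma>)) * (p2 * L2 * ?U)"
      using constants_pos by (intro mult_left_mono) auto
    then show "(P2 *v f2 (x \<sigma>)) \<bullet> (jac2 f2 (x \<sigma>) *v (f2 (x \<sigma>) + ?e))
      \<le> - (q2/2) * (norm (f2 (x \<sigma>)))\<^sup>2 + norm (f2 (x \<sigma>)) * (p2 * L2 * ?U)"
      using fast_dissipation_perturbed[of "f2 (x \<sigma>)" "x \<sigma>" ?e] by linarith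
  qed (use s rate_pos constants_pos P2 in auto)
  then show ?thesis
    by simp
qed


lemma boundary_layer_estimate:
  obtains kd gd where "0 \<le> kd" "0 \<le> gd"
    "\<And>x t0 T s. solves x t0 T \<Longrightarrow> s \<in> {t0..T} \<Longrightarrow>
      (norm (snd (x s) - xs (fst (x s))))\<^sup>2
        \<le> kd * exp (- rate * (s - t0)) * (norm (x t0 - xstar))\<^sup>2 + gd * (sup_error x t0 T)\<^sup>2"
proof
  define \<kappa> where "\<kappa> = L2 * (1 + gain * L2)"
  define C where "C = (2/q2) * (p2 * L2)\<^sup>2 / (q2 / (2 * p2))"
  show "0 \<le> gain\<^sup>2 * p2 * \<kappa>\<^sup>2 / m2" "0 \<le> gain\<^sup>2 * C / m2"
    using constants_pos by (simp_all add: C_def)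
  fix x t0 T s
  assume sol: "solves x t0 T" and s: "s \<in> {t0..T}"
  define E where "E = exp (- rate * (s - t0))"
  let ?W = "\<lambda>\<sigma>. f2 (x \<sigma>) \<bullet> (P2 *v f2 (x \<sigma>))" and ?r = "norm (x t0 - xstar)" and ?U = "sup_error x t0 T"
  have "?W t0 \<le> p2 * (norm (f2 (x t0)))\<^sup>2"
    by (rule quadratic_form_le_onorm)
  also have "\<dots> \<le> p2 * (\<kappa> * ?r)\<^sup>2"
    unfolding \<kappa>_def using constants_pos norm_f2_le_dist_steady_state
    by (intro mult_left_mono power_mono) auto
  finally have "E * ?W t0 \<le> E * (p2 * (\<kappa> * ?r)\<^sup>2)"
    by (intro mult_left_mono) (auto simp: E_def)
  moreover have "(2/q2) * (p2 * L2 * ?U)\<^sup>2 / (q2 / (2 * p2)) = C * ?U\<^sup>2"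
    by (simp add: C_def power_mult_distrib)
  ultimately have W: "?W s \<le> E * (p2 * (\<kappa> * ?r)\<^sup>2) + C * ?U\<^sup>2"
    using fast_energy_decay[OF sol s] unfolding E_def by linarith
  have "(norm (snd (x s) - xs (fst (x s))))\<^sup>2 \<le> (gain * norm (f2 (x s)))\<^sup>2"
    using dist_slow_manifold_le[of "snd (x s)" "fst (x s)"] by (intro power_mono) auto
  also have "\<dots> \<le> gain\<^sup>2 * (?W s / m2)"
    using coercivity_le[of P2 "f2 (x s)"] constants_pos by (simp add: power_mult_distrib field_simps)
  also have "\<dots> \<le> gain\<^sup>2 * ((E * (p2 * (\<kappa> * ?r)\<^sup>2) + C * ?U\<^sup>2) / m2)"
    using W constants_pos by (intro mult_left_mono divide_right_mono) auto
  also have "\<dots> = gain\<^sup>2 * p2 * \<kappa>\<^sup>2 / m2 * E * ?r\<^sup>2 + gain\<^sup>2 * C / m2 * ?U\<^sup>2"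
    by (simp add: power_mult_distrib add_divide_distrib algebra_simps)
  finally show "(norm (snd (x s) - xs (fst (x s))))\<^sup>2
      \<le> gain\<^sup>2 * p2 * \<kappa>\<^sup>2 / m2 * exp (- rate * (s - t0)) * ?r\<^sup>2 + gain\<^sup>2 * C / m2 * ?U\<^sup>2"
    by (simp add: E_def)
qed


lemma slow_energy_decay:
  assumes sol: "solves x t0 T" and AB: "0 \<le> A" "0 \<le> B"
    and layer: "\<And>s. t0 < s \<Longrightarrow> s < T \<Longrightarrow>
      (norm (snd (x s) - xs (fst (x s))))\<^sup>2 \<le> A * exp (- rate * (s - t0)) + B"
  shows "(fst (x T) - x1s) \<bullet> (P1 *v (fst (x T) - x1s)) \<le> exp (- rate * (T - t0))
      * ((fst (x t0) - x1s) \<bullet> (P1 *v (fst (x t0) - x1s)) + (2/q1) * ((p1 * L1)\<^sup>2 * A) / (q1 / (2 * p1) - rate))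
    + (2/q1) * ((p1 * L1)\<^sup>2 * B) / (q1 / (2 * p1))"
proof (rule quadratic_lyapunov_decay[where v = "\<lambda>\<sigma>. fst (x \<sigma>) - x1s" and v' = "\<lambda>\<sigma>. f1 (x \<sigma>)"
      and c = "\<lambda>\<sigma>. p1 * L1 * norm (snd (x \<sigma>) - xs (fst (x \<sigma>)))"])
  show "q1 / (2 * p1) * (u \<bullet> (P1 *v u)) \<le> (q1/2) * (norm u)\<^sup>2" for u
    using constants_pos by (intro quadratic_form_rate_le) auto
  show "continuous_on {t0..T} (\<lambda>\<sigma>. fst (x \<sigma>) - x1s)"
    using sol by (auto simp: solves_def intro!: continuous_intros)
  fix \<sigma>
  assume \<sigma>: "t0 < \<sigma>" "\<sigma> < T"
  then have "(x has_vector_derivative (f1 (x \<sigma>), f2 (x \<sigma>) + Shat (x \<sigma>) *v f1 (x \<sigma>))) (at \<sigma>)"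
    using sol by (simp add: solves_def)
  from bounded_linear.has_vector_derivative[OF bounded_linear_fst this]
  show "((\<lambda>\<sigma>. fst (x \<sigma>) - x1s) has_vector_derivative f1 (x \<sigma>)) (at \<sigma>)"
    by (simp add: has_vector_derivative_diff_const)
  show "(P1 *v (fst (x \<sigma>) - x1s)) \<bullet> f1 (x \<sigma>) \<le> - (q1/2) * (norm (fst (x \<sigma>) - x1s))\<^sup>2
      + norm (fst (x \<sigma>) - x1s) * (p1 * L1 * norm (snd (x \<sigma>) - xs (fst (x \<sigma>))))"
    by (rule reduced_dissipation_perturbed)
  have "(p1 * L1)\<^sup>2 * (norm (snd (x \<sigma>) - xs (fst (x \<sigma>))))\<^sup>2
      \<le> (p1 * L1)\<^sup>2 * (A * exp (- rate * (\<sigma> - t0)) + B)"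
    using layer[OF \<sigma>] by (rule mult_left_mono) simp
  then show "(p1 * L1 * norm (snd (x \<sigma>) - xs (fst (x \<sigma>))))\<^sup>2
      \<le> (p1 * L1)\<^sup>2 * A * exp (- rate * (\<sigma> - t0)) + (p1 * L1)\<^sup>2 * B"
    by (simp add: power_mult_distrib algebra_simps)
qed (use sol P1 constants_pos rate_pos AB in \<open>auto simp: solves_def\<close>)

lemma reduced_estimate:
  obtains ky gy where "0 \<le> ky" "0 \<le> gy"
    "\<And>x t0 T. solves x t0 T \<Longrightarrow>
      (norm (fst (x T) - x1s))\<^sup>2 \<le> ky * exp (- rate * (T - t0)) * (norm (x t0 - xstar))\<^sup>2 + gy * (sup_error x t0 T)\<^sup>2"
proof -
  obtain kd gd where kd: "0 \<le> kd" "0 \<le> gd" and layer: "\<And>x t0 T s. solves x t0 T \<Longrightarrow> s \<in> {t0..T} \<Longrightarrow>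
      (norm (snd (x s) - xs (fst (x s))))\<^sup>2
        \<le> kd * exp (- rate * (s - t0)) * (norm (x t0 - xstar))\<^sup>2 + gd * (sup_error x t0 T)\<^sup>2"
    using boundary_layer_estimate by blast
  define a1 where "a1 = q1 / (2 * p1)"
  define C where "C = (2/q1) * (p1 * L1)\<^sup>2"
  have a1: "0 < a1" "rate < a1"
    using constants_pos rate_pos by (simp_all add: a1_def)
  show thesis
  proof (rule that)
    show "0 \<le> (p1 + C * kd / (a1 - rate)) / m1" "0 \<le> C * gd / a1 / m1"
      using constants_pos kd a1 by (simp_all add: C_def)
    fix x t0 T
    assume sol: "solves x t0 T"
    let ?y = "\<lambda>\<sigma>. fst (x \<sigma>) - x1s" and ?r = "norm (x t0 - xstar)" and ?U = "sup_error x t0 T"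
    define E where "E = exp (- rate * (T - t0))"
    have "(norm (snd (x s) - xs (fst (x s))))\<^sup>2 \<le> kd * ?r\<^sup>2 * exp (- rate * (s - t0)) + gd * ?U\<^sup>2"
      if "t0 < s" "s < T" for s
      using layer[OF sol, of s] that by (simp add: mult_ac)
    from slow_energy_decay[OF sol _ _ this]
    have V: "?y T \<bullet> (P1 *v ?y T) \<le> E * (?y t0 \<bullet> (P1 *v ?y t0) + C * kd * ?r\<^sup>2 / (a1 - rate))
        + C * gd * ?U\<^sup>2 / a1"
      using kd by (simp add: E_def C_def a1_def mult_ac)
    have "norm (?y t0) \<le> ?r"
      using norm_fst_snd_le(1)[of "x t0 - xstar"] by simp
    then have "p1 * (norm (?y t0))\<^sup>2 \<le> p1 * ?r\<^sup>2"
      using constants_pos by (intro mult_left_mono power_mono) auto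
    then have "?y t0 \<bullet> (P1 *v ?y t0) \<le> p1 * ?r\<^sup>2"
      using quadratic_form_le_onorm[of "?y t0" P1] by linarith
    then have "E * (?y t0 \<bullet> (P1 *v ?y t0) + C * kd * ?r\<^sup>2 / (a1 - rate))
        \<le> E * (p1 * ?r\<^sup>2 + C * kd * ?r\<^sup>2 / (a1 - rate))"
      by (intro mult_left_mono) (auto simp: E_def)
    then have "m1 * (norm (?y T))\<^sup>2 \<le> E * (p1 * ?r\<^sup>2 + C * kd * ?r\<^sup>2 / (a1 - rate)) + C * gd * ?U\<^sup>2 / a1"
      using V coercivity_le[of P1 "?y T"] by linarith
    then show "(norm (fst (x T) - x1s))\<^sup>2
        \<le> (p1 + C * kd / (a1 - rate)) / m1 * exp (- rate * (T - t0)) * ?r\<^sup>2 + C * gd / a1 / m1 * ?U\<^sup>2"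
      using constants_pos by (simp add: E_def field_simps)
  qed
qed

lemma norm_dist_steady_state_le:
  "(norm (z - xstar))\<^sup>2 \<le> (1 + 2 * (gain * L2)\<^sup>2) * (norm (fst z - x1s))\<^sup>2 + 2 * (norm (snd z - xs (fst z)))\<^sup>2"
proof -
  define g where "g = gain * L2"
  obtain z1 z2 where z: "z = (z1, z2)"
    by fastforce
  have "norm (z2 - xs x1s) \<le> norm (z2 - xs z1) + norm (xs z1 - xs x1s)"
    using norm_triangle_ineq[of "z2 - xs z1" "xs z1 - xs x1s"] by simp
  also have "\<dots> \<le> norm (z2 - xs z1) + g * norm (z1 - x1s)"
    using xs_lipschitz by (simp add: g_def)
  finally have "(norm (z2 - xs x1s))\<^sup>2 \<le> (norm (z2 - xs z1) + g * norm (z1 - x1s))\<^sup>2"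
    by (intro power_mono) auto
  also have "\<dots> \<le> 2 * (norm (z2 - xs z1))\<^sup>2 + 2 * g\<^sup>2 * (norm (z1 - x1s))\<^sup>2"
  proof -
    have "(u + v)\<^sup>2 \<le> 2 * u\<^sup>2 + 2 * v\<^sup>2" for u v :: real
      using zero_le_power2[of "u - v"] by (simp add: power2_eq_square algebra_simps)
    from this[of "norm (z2 - xs z1)" "g * norm (z1 - x1s)"] show ?thesis
      by (simp add: power_mult_distrib)
  qed
  moreover have "(norm (z - xstar))\<^sup>2 = (norm (z1 - x1s))\<^sup>2 + (norm (z2 - xs x1s))\<^sup>2"
    using z by (simp add: norm_Pair)
  ultimately have "(norm (z - xstar))\<^sup>2 \<le> (1 + 2 * g\<^sup>2) * (norm (z1 - x1s))\<^sup>2 + 2 * (norm (z2 - xs z1))\<^sup>2"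
    by (simp add: distrib_right)
  then show ?thesis
    using z by (simp only: g_def fst_conv snd_conv)
qed

lemma state_estimate:
  obtains K G where "0 < K" "0 < G"
    "\<And>x t0 T. solves x t0 T \<Longrightarrow>
      (norm (x T - xstar))\<^sup>2 \<le> K * exp (- rate * (T - t0)) * (norm (x t0 - xstar))\<^sup>2 + G * (sup_error x t0 T)\<^sup>2"
proof -
  obtain kd gd where kd: "0 \<le> kd" "0 \<le> gd" and layer: "\<And>x t0 T s. solves x t0 T \<Longrightarrow> s \<in> {t0..T} \<Longrightarrow>
      (norm (snd (x s) - xs (fst (x s))))\<^sup>2
        \<le> kd * exp (- rate * (s - t0)) * (norm (x t0 - xstar))\<^sup>2 + gd * (sup_error x t0 T)\<^sup>2"
    using boundary_layer_estimate by blast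
  obtain ky gy where ky: "0 \<le> ky" "0 \<le> gy" and reduced: "\<And>x t0 T. solves x t0 T \<Longrightarrow>
      (norm (fst (x T) - x1s))\<^sup>2 \<le> ky * exp (- rate * (T - t0)) * (norm (x t0 - xstar))\<^sup>2 + gy * (sup_error x t0 T)\<^sup>2"
    using reduced_estimate by blast
  define c where "c = 1 + 2 * (gain * L2)\<^sup>2"
  have "0 \<le> c"
    by (simp add: c_def)
  show thesis
  proof (rule that)
    show "0 < c * ky + 2 * kd + 1" "0 < c * gy + 2 * gd + 1"
      using kd ky \<open>0 \<le> c\<close> by (intro add_nonneg_pos add_nonneg_nonneg mult_nonneg_nonneg; simp)+
    fix x t0 T
    assume sol: "solves x t0 T"
    let ?R = "exp (- rate * (T - t0)) * (norm (x t0 - xstar))\<^sup>2" and ?U = "sup_error x t0 T"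
    have "t0 \<le> T"
      using sol by (simp add: solves_def)
    have "(norm (x T - xstar))\<^sup>2
        \<le> c * (norm (fst (x T) - x1s))\<^sup>2 + 2 * (norm (snd (x T) - xs (fst (x T))))\<^sup>2"
      unfolding c_def by (rule norm_dist_steady_state_le)
    also have "\<dots> \<le> c * (ky * ?R + gy * ?U\<^sup>2) + 2 * (kd * ?R + gd * ?U\<^sup>2)"
      using reduced[OF sol] layer[OF sol, of T] \<open>t0 \<le> T\<close> \<open>0 \<le> c\<close>
      by (intro add_mono mult_left_mono) (simp_all add: mult.assoc)
    also have "\<dots> \<le> (c * ky + 2 * kd + 1) * ?R + (c * gy + 2 * gd + 1) * ?U\<^sup>2"
      by (simp add: algebra_simps)
    finally show "(norm (x T - xstar))\<^sup>2 \<le> (c * ky + 2 * kd + 1) * exp (- rate * (T - t0))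
        * (norm (x t0 - xstar))\<^sup>2 + (c * gy + 2 * gd + 1) * ?U\<^sup>2"
      by (simp add: mult.assoc)
  qed
qed

lemma input_to_state_stable:
  "\<exists>\<beta> \<gamma>. class_KL \<beta> \<and> class_K \<gamma> \<and>
    (\<forall>(x :: real \<Rightarrow> (real^'n1) \<times> (real^'n2)) J t0.
       is_interval J \<and> t0 \<in> J \<and>
       (\<forall>t\<in>J. (x has_vector_derivative
                  (f1 (x t), f2 (x t) + Shat (x t) *v f1 (x t))) (at t within J)) \<longrightarrow>
       (\<forall>t\<in>J. t \<ge> t0 \<longrightarrow>
          norm (x t - xstar) \<le> \<beta> (norm (x t0 - xstar)) (t - t0) + \<gamma> (sup_error x t0 t)))"
proof -
  obtain K G where KG: "0 < K" "0 < G" and estimate: "\<And>x t0 T. solves x t0 T \<Longrightarrow>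
      (norm (x T - xstar))\<^sup>2 \<le> K * exp (- rate * (T - t0)) * (norm (x t0 - xstar))\<^sup>2 + G * (sup_error x t0 T)\<^sup>2"
    using state_estimate by blast
  show ?thesis
  proof (intro exI conjI allI impI ballI)
    show "class_KL (\<lambda>r s. sqrt K * r * exp (- (rate/2) * s))"
      using KG rate_pos by (intro class_KL_exp_decay) auto
    show "class_K (\<lambda>u. sqrt G * u)"
      using KG by (intro class_K_scale) auto
    fix x :: "real \<Rightarrow> (real^'n1) \<times> (real^'n2)" and J t0 t
    assume "is_interval J \<and> t0 \<in> J \<and>
      (\<forall>t\<in>J. (x has_vector_derivative (f1 (x t), f2 (x t) + Shat (x t) *v f1 (x t))) (at t within J))"
      and t: "t \<in> J" "t0 \<le> t"
    then have sol: "solves x t0 t"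
      using has_vector_derivative_on_subinterval[of J t0 t x] by (auto simp: solves_def)
    have "exp (- rate * (t - t0)) = (exp (- (rate/2) * (t - t0)))\<^sup>2"
      by (simp add: power2_eq_square exp_add[symmetric])
    then have "(norm (x t - xstar))\<^sup>2
        \<le> K * (exp (- (rate/2) * (t - t0)) * norm (x t0 - xstar))\<^sup>2 + G * (sup_error x t0 t)\<^sup>2"
      using estimate[OF sol] by (simp add: power_mult_distrib)
    from le_sqrt_weighted_squares[OF _ _ this] show "norm (x t - xstar)
        \<le> sqrt K * norm (x t0 - xstar) * exp (- (rate/2) * (t - t0)) + sqrt G * sup_error x t0 t"
      using KG sup_error_nonneg[OF sol] by (simp add: mult_ac)
  qed
qed

end

theorem proposition5:
  fixes f1 :: "(real^'n1) \<times> (real^'n2) \<Rightarrow> real^'n1"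
    and f2 :: "(real^'n1) \<times> (real^'n2) \<Rightarrow> real^'n2"
    and xs :: "real^'n1 \<Rightarrow> real^'n2"
    and x1s :: "real^'n1"
    and P1 Q1 :: "real^'n1^'n1"
    and P2 Q2 :: "real^'n2^'n2"
    and Shat :: "(real^'n1) \<times> (real^'n2) \<Rightarrow> real^'n1^'n2"
  assumes C1_f1: "C1_map f1" and C1_f2: "C1_map f2"
    and inv2: "\<forall>z. invertible (jac2 f2 z)"
    and C1_xs: "C1_map xs"
    and ss_map: "\<forall>x1. f2 (x1, xs x1) = 0"
    and ss: "f1 (x1s, xs x1s) = 0"
    and lip1: "\<exists>L. L-lipschitz_on UNIV f1"
    and lip2: "\<exists>L. L-lipschitz_on UNIV f2"
    and P1: "sym_pos_def P1" and Q1: "sym_pos_def Q1"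
    and P2: "sym_pos_def P2" and Q2: "sym_pos_def Q2"
    and contr1: "\<forall>x1. loewner_le (P1 ** jac_red f1 xs x1 + transpose (jac_red f1 xs x1) ** P1) (- Q1)"
    and contr2: "\<forall>z. loewner_le (P2 ** jac2 f2 z + transpose (jac2 f2 z) ** P2) (- Q2)"
    and loclip: "locally_lipschitz (\<lambda>z. (f1 z, f2 z + Shat z *v f1 z))"
  shows "\<exists>\<beta> \<gamma>. class_KL \<beta> \<and> class_K \<gamma> \<and>
    (\<forall>(x :: real \<Rightarrow> (real^'n1) \<times> (real^'n2)) J t0.
       is_interval J \<and> t0 \<in> J \<and>
       (\<forall>t\<in>J. (x has_vector_derivative
                  (f1 (x t), f2 (x t) + Shat (x t) *v f1 (x t))) (at t within J)) \<longrightarrow>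
       (\<forall>t\<in>J. t \<ge> t0 \<longrightarrow>
          norm (x t - (x1s, xs x1s)) \<le>
            \<beta> (norm (x t0 - (x1s, xs x1s))) (t - t0)
            + \<gamma> (SUP s\<in>{t0..t}. norm ((sens f2 (x s) - Shat (x s)) *v f1 (x s)))))"
proof -
  obtain L1 L2 where "L1-lipschitz_on UNIV f1" "L2-lipschitz_on UNIV f2"
    using lip1 lip2 by blast
  then interpret predictive_sensitivity_system f1 f2 xs x1s P1 Q1 P2 Q2 Shat L1 L2
    using C1_f1 C1_f2 C1_xs inv2 ss_map ss P1 Q1 P2 Q2 contr1 contr2
      continuous_on_UNIV_if_locally_lipschitz[OF loclip]
    by unfold_locales (simp_all add: C1_map_differentiable del: split_paired_All)
  show ?thesis
    by (rule input_to_state_stable)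
qed

end
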